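(* Let $k\ge 1$ and $t\ge 1$ be integers and let $c\colon E(K_{2kt+1})\to[k]$ be a colour-balanced $k$-edge-colouring of the complete graph $K_{2kt+1}$. Then there is a colour-balanced spanning tree of $K_{2kt+1}$.
   Context: $[k]=\{1,\dots,k\}$. A $k$-edge-colouring is an arbitrary (not necessarily proper) map from the edge set to $[k]$; it is colour-balanced if all $k$ colour classes have the same size. A subgraph is colour-balanced if each of the $k$ colours appears on equally many of its edges (so a colour-balanced spanning tree of $K_{2kt+1}$ has exactly $2t$ edges of each colour). *)

theory Defs
  imports "HOL-Library.FuncSet"
begin

text \<open>
  A finite simple undirected graph is given by a vertex set V and a set E of two-element subsets
  of V. (The notion of spanning tree in the AFP entry Graph-Theory is for digraphs and forbids only
  directed cycles, so it does not specialise to undirected spanning trees.)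
\<close>

definition simple_graph :: "'a set \<Rightarrow> 'a set set \<Rightarrow> bool" where
  "simple_graph V E \<longleftrightarrow> finite V \<and> (\<forall>e\<in>E. e \<subseteq> V \<and> card e = 2)"

definition complete_graph_edges :: "'a set \<Rightarrow> 'a set set" where
  "complete_graph_edges V = {e. e \<subseteq> V \<and> card e = 2}"

definition adjacency :: "'a set set \<Rightarrow> ('a \<times> 'a) set" where
  "adjacency E = {(u, v). {u, v} \<in> E}"

definition graph_connected :: "'a set \<Rightarrow> 'a set set \<Rightarrow> bool" where
  "graph_connected V E \<longleftrightarrow> V \<noteq> {} \<and> (\<forall>u\<in>V. \<forall>v\<in>V. (u, v) \<in> (adjacency E)\<^sup>*)"

text \<open>A cycle is listed by its distinct vertices; the index is taken modulo the length so that the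
  edge from the last vertex back to the first one is included.\<close>

definition graph_cycle :: "'a set set \<Rightarrow> 'a list \<Rightarrow> bool" where
  "graph_cycle E p \<longleftrightarrow> 3 \<le> length p \<and> distinct p \<and>
     (\<forall>i<length p. {p ! i, p ! (Suc i mod length p)} \<in> E)"

definition graph_tree :: "'a set \<Rightarrow> 'a set set \<Rightarrow> bool" where
  "graph_tree V T \<longleftrightarrow> simple_graph V T \<and> graph_connected V T \<and> (\<nexists>p. graph_cycle T p)"

definition graph_spanning_tree :: "'a set \<Rightarrow> 'a set set \<Rightarrow> 'a set set \<Rightarrow> bool" where
  "graph_spanning_tree V E T \<longleftrightarrow> T \<subseteq> E \<and> graph_tree V T"

definition edge_colouring :: "nat \<Rightarrow> 'a set set \<Rightarrow> ('a set \<Rightarrow> nat) \<Rightarrow> bool" where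
  "edge_colouring k E c \<longleftrightarrow> c \<in> E \<rightarrow> {1..k}"

text \<open>Applied to the full edge set, this says that the colouring is balanced; applied to the edge
  set of a subgraph, that the subgraph is balanced.\<close>

definition colour_balanced :: "nat \<Rightarrow> ('a set \<Rightarrow> nat) \<Rightarrow> 'a set set \<Rightarrow> bool" where
  "colour_balanced k c F \<longleftrightarrow>
     (\<forall>i\<in>{1..k}. \<forall>j\<in>{1..k}. card {e \<in> F. c e = i} = card {e \<in> F. c e = j})"

end

theory Submission
  imports Defs
begin

text \<open>
  By Rado's theorem for the graphic matroid, applied to the family in which every colour class
  occurs \<open>2t\<close> times, it suffices that the edges in any \<open>s\<close> colours have rank at least \<open>2ts\<close>.
  They form a graph with \<open>stn\<close> edges on \<open>n = 2kt + 1\<close> vertices, so some vertex has degree at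
  least the average degree \<open>2ts\<close>, and its star alone already has this rank.
\<close>

section \<open>Rado's theorem for submodular functions\<close>

text \<open>Adding the elements of \<open>Y - X\<close> one at a time to both \<open>X\<close> and
  \<open>X \<inter> Y\<close> raises the rank of the larger set by no more than that of the smaller;
  summing the increments gives the inequality.\<close>

lemma submodular_if_decreasing_marginals:
  fixes r :: "'b set \<Rightarrow> nat"
  assumes marginal: "\<And>X Y e. X \<subseteq> Y \<Longrightarrow> insert e Y \<subseteq> E \<Longrightarrow>
      r (insert e Y) + r X \<le> r (insert e X) + r Y"
    and "finite E" "X \<subseteq> E" "Y \<subseteq> E"
  shows "r (X \<union> Y) + r (X \<inter> Y) \<le> r X + r Y"
proof -
  have "r (X \<union> Z) + r (X \<inter> Y) \<le> r X + r ((X \<inter> Y) \<union> Z)" if "finite Z" "Z \<subseteq> E" for Z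
    using that
  proof (induction Z rule: finite_induct)
    case (insert e Z)
    have "r (insert e (X \<union> Z)) + r ((X \<inter> Y) \<union> Z) \<le> r (insert e ((X \<inter> Y) \<union> Z)) + r (X \<union> Z)"
      using insert.prems assms by (intro marginal) auto
    with insert show ?case by simp
  qed simp
  moreover have "finite (Y - X)" "Y - X \<subseteq> E"
    using assms(2,4) by (auto intro: finite_subset)
  moreover have "X \<union> (Y - X) = X \<union> Y" "(X \<inter> Y) \<union> (Y - X) = Y" by auto
  ultimately show ?thesis by metis
qed

text \<open>The sets are shrunk one element at a time, preserving the Hall-type condition, until all
  are singletons. Together with \<open>card_bound\<close>, the conclusion makes \<open>f\<close>
  injective on \<open>I\<close>, with an independent image.\<close>

lemma rado:
  fixes A :: "'i \<Rightarrow> 'b set" and r :: "'b set \<Rightarrow> nat"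
  assumes "finite E" "finite I" "\<And>i. i \<in> I \<Longrightarrow> A i \<subseteq> E"
    and card_bound: "\<And>X. X \<subseteq> E \<Longrightarrow> r X \<le> card X"
    and mono: "\<And>X Y. X \<subseteq> Y \<Longrightarrow> Y \<subseteq> E \<Longrightarrow> r X \<le> r Y"
    and submod: "\<And>X Y. X \<subseteq> E \<Longrightarrow> Y \<subseteq> E \<Longrightarrow> r (X \<union> Y) + r (X \<inter> Y) \<le> r X + r Y"
    and hall: "\<And>J. J \<subseteq> I \<Longrightarrow> card J \<le> r (\<Union>(A ` J))"
  shows "\<exists>f. (\<forall>i\<in>I. f i \<in> A i) \<and> card I \<le> r (f ` I)"
  using assms(3) hall
proof (induction "\<Sum>i\<in>I. card (A i)" arbitrary: A rule: less_induct)
  case less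
  have fin: "finite (A i)" if "i \<in> I" for i
    using less.prems(1)[OF that] \<open>finite E\<close> by (rule finite_subset)
  show ?case
  proof (cases "\<exists>i\<in>I. \<exists>x\<in>A i. \<exists>y\<in>A i. x \<noteq> y")
    case False
    have "A i \<noteq> {}" if "i \<in> I" for i
    proof -
      have "1 \<le> r (A i)" using less.prems(2)[of "{i}"] that by simp
      with card_bound[OF less.prems(1)[OF that]] show ?thesis by auto
    qed
    then have "\<forall>i\<in>I. \<exists>x. x \<in> A i" by blast
    then obtain f where f: "\<And>i. i \<in> I \<Longrightarrow> f i \<in> A i" by metis
    \<comment> \<open>With singletons only, the image of \<open>f\<close> is the whole union, so the
      hypothesis for \<open>J = I\<close> is already the claim.\<close>
    with False have "A i = {f i}" if "i \<in> I" for i using that by blast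
    then have "\<Union>(A ` I) = f ` I" by auto
    with f less.prems(2)[of I] show ?thesis by auto
  next
    case True
    then obtain i x y where i: "i \<in> I" and xy: "x \<in> A i" "y \<in> A i" "x \<noteq> y" by blast
    \<comment> \<open>Says that the rank condition fails for \<open>insert i J\<close> once
      \<open>z\<close> is deleted from \<open>A i\<close>: as \<open>i\<close> is not in
      \<open>J\<close>, that index set has \<open>card J + 1\<close> elements, so failure means rank
      at most \<open>card J\<close>.\<close>
    define violates where "violates z J \<longleftrightarrow> J \<subseteq> I - {i} \<and> r (\<Union>(A ` J) \<union> (A i - {z})) \<le> card J" for z J
    have shrink: ?thesis if z: "z \<in> A i" "\<nexists>J. violates z J" for z
    proof -
      let ?B = "A(i := A i - {z})"
      have "(\<Sum>j\<in>I. card (?B j)) < (\<Sum>j\<in>I. card (A j))"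
        using i z fin \<open>finite I\<close> card_Diff1_less[of "A i" z]
        by (intro sum_strict_mono_ex1) (auto intro!: bexI[of _ i] card_Diff1_le simp del: card_Diff_insert)
      moreover have "?B j \<subseteq> E" if "j \<in> I" for j
        using less.prems(1)[OF that] by auto
      moreover have "card J \<le> r (\<Union>(?B ` J))" if "J \<subseteq> I" for J
      proof (cases "i \<in> J")
        case True
        then have eq: "\<Union>(?B ` J) = \<Union>(A ` (J - {i})) \<union> (A i - {z})" by auto
        have "\<not> violates z (J - {i})" using z by blast
        with that have "card (J - {i}) < r (\<Union>(?B ` J))"
          unfolding violates_def eq by auto
        then show ?thesis using True by simp
      next
        case False
        then have "\<Union>(?B ` J) = \<Union>(A ` J)" by auto
        then show ?thesis using less.prems(2)[OF that] by simp
      qed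
      ultimately have "\<exists>f. (\<forall>j\<in>I. f j \<in> ?B j) \<and> card I \<le> r (f ` I)"
        by (rule less.hyps)
      moreover have "?B j \<subseteq> A j" for j by auto
      ultimately show ?thesis by blast
    qed
    \<comment> \<open>If deleting \<open>x\<close> and deleting \<open>y\<close> were both violating, submodularity would break the
      hypothesis for the union of the two index sets together with \<open>i\<close>.\<close>
    have "(\<nexists>J. violates x J) \<or> (\<nexists>J. violates y J)"
    proof (rule ccontr)
      assume "\<not> ?thesis"
      then obtain J K where JK: "violates x J" "violates y K" by blast
      let ?X = "\<Union>(A ` J) \<union> (A i - {x})" and ?Y = "\<Union>(A ` K) \<union> (A i - {y})"
      have sub: "J \<subseteq> I" "K \<subseteq> I" "i \<notin> J" "i \<notin> K" and finJK: "finite J" "finite K"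
        using JK \<open>finite I\<close> finite_subset unfolding violates_def by blast+
      have XY: "?X \<subseteq> E" "?Y \<subseteq> E" using sub less.prems(1) i by blast+
      have "card (insert i (J \<union> K)) \<le> r (\<Union>(A ` insert i (J \<union> K)))"
        using sub i by (intro less.prems(2)) auto
      also have "\<Union>(A ` insert i (J \<union> K)) = ?X \<union> ?Y" using xy by auto
      finally have 1: "card (J \<union> K) + 1 \<le> r (?X \<union> ?Y)" using sub finJK by simp
      have "card (J \<inter> K) \<le> r (\<Union>(A ` (J \<inter> K)))"
        using sub by (intro less.prems(2)) auto
      also have "\<dots> \<le> r (?X \<inter> ?Y)" using XY by (intro mono) auto
      finally have 2: "card (J \<inter> K) \<le> r (?X \<inter> ?Y)" .
      have "r ?X + r ?Y \<le> card J + card K" using JK unfolding violates_def by auto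
      with 1 2 submod[OF XY] card_Un_Int[OF finJK] show False by linarith
    qed
    then show ?thesis using shrink xy by blast
  qed
qed

section \<open>The rank function of the graphic matroid\<close>

definition component :: "'a set set \<Rightarrow> 'a \<Rightarrow> 'a set" where
  "component F u = (adjacency F)\<^sup>* `` {u}"

text \<open>The rank of a graph in the graphic matroid: number of vertices minus number of
  components. For finite \<open>V\<close> the subtraction is never truncated.\<close>

definition graph_rank :: "'a set \<Rightarrow> 'a set set \<Rightarrow> nat" where
  "graph_rank V F = card V - card (component F ` V)"

section \<open>Components and rank when an edge is added\<close>

lemma sym_rtrancl_adjacency: "sym ((adjacency F)\<^sup>*)"
  by (intro sym_rtrancl symI) (simp add: adjacency_def insert_commute)

lemma component_eq_iff: "component F u = component F v \<longleftrightarrow> v \<in> component F u"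
proof -
  have "equiv UNIV ((adjacency F)\<^sup>*)"
    by (simp add: equiv_def refl_rtrancl sym_rtrancl_adjacency trans_rtrancl)
  from eq_equiv_class_iff[OF this] show ?thesis by (simp add: component_def)
qed

lemma component_mono: "F \<subseteq> G \<Longrightarrow> component F u \<subseteq> component G u"
  unfolding component_def adjacency_def by (intro Image_mono rtrancl_mono) auto

lemma component_mono_eq:
  "F \<subseteq> G \<Longrightarrow> component F u = component F v \<Longrightarrow> component G u = component G v"
  unfolding component_eq_iff by (rule subsetD[OF component_mono])

lemma component_edge: "{u, v} \<in> F \<Longrightarrow> component F u = component F v"
  unfolding component_eq_iff by (auto simp: component_def adjacency_def)

text \<open>A path in the enlarged graph can be taken either to avoid the new edge or to cross it
  once, in one of two directions. Since \<open>adjacency\<close> gains both ordered pairs,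
  \<open>rtrancl_insert\<close> is applied twice.\<close>

lemma component_insert_cases:
  assumes "component (insert {a, b} F) u = component (insert {a, b} F) v"
  shows "component F u = component F v \<or> component F u = component F a \<and> component F v = component F b
    \<or> component F u = component F b \<and> component F v = component F a"
proof -
  have "adjacency (insert {a, b} F) = insert (a, b) (insert (b, a) (adjacency F))"
    by (auto simp: adjacency_def doubleton_eq_iff)
  with assms have "(u, v) \<in> (insert (a, b) (insert (b, a) (adjacency F)))\<^sup>*"
    unfolding component_eq_iff by (simp add: component_def)
  moreover have "(x, y) \<in> (adjacency F)\<^sup>* \<longleftrightarrow> component F x = component F y" for x y
    unfolding component_eq_iff by (simp add: component_def)
  ultimately show ?thesis
    unfolding rtrancl_insert Un_iff mem_Collect_eq case_prod_conv by metis
qed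

text \<open>On \<open>W\<close> the map \<open>g\<close> factors through \<open>f\<close>. It serves
  to compare numbers of components of two graphs.\<close>

lemma card_image_le_card_image:
  assumes "finite W" "\<And>u v. f u = f v \<Longrightarrow> u \<in> W \<Longrightarrow> v \<in> W \<Longrightarrow> g u = g v"
  shows "card (g ` W) \<le> card (f ` W)"
proof -
  have "g u = g (inv_into W f (f u))" if "u \<in> W" for u
    using that by (intro assms(2)) (simp_all add: f_inv_into_f inv_into_into)
  then have "g ` W \<subseteq> (\<lambda>x. g (inv_into W f x)) ` f ` W" by blast
  then show ?thesis using assms(1) by (meson finite_imageI surj_card_le)
qed

text \<open>Leave out the old component of \<open>a\<close>. The remaining vertices
  \<open>?W\<close> still represent every new component, as \<open>b\<close> stands for the merged
  one, and exactly one old component is missing.\<close>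

lemma card_component_insert:
  assumes "finite V" "a \<in> V" "b \<in> V" "component F a \<noteq> component F b"
  shows "Suc (card (component (insert {a, b} F) ` V)) = card (component F ` V)"
proof -
  let ?G = "insert {a, b} F"
  let ?W = "{u \<in> V. component F u \<noteq> component F a}"
  have ab: "component ?G a = component ?G b" by (rule component_edge) simp
  have "component ?G ` V = component ?G ` ?W"
  proof
    show "component ?G ` V \<subseteq> component ?G ` ?W"
    proof
      fix C assume "C \<in> component ?G ` V"
      then obtain u where u: "u \<in> V" "C = component ?G u" by blast
      show "C \<in> component ?G ` ?W"
      proof (cases "component F u = component F a")
        case True
        then have "C = component ?G b" using ab u component_mono_eq[of F ?G u a] by auto
        moreover have "b \<in> ?W" using assms by auto
        ultimately show ?thesis by blast
      qed (use u in blast)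
    qed
  qed auto
  \<comment> \<open>The two crossing cases would put \<open>u\<close> or \<open>v\<close> into the
    old component of \<open>a\<close>, which \<open>?W\<close> excludes; so both graphs partition
    \<open>?W\<close> alike.\<close>
  moreover have "component ?G u = component ?G v \<longleftrightarrow> component F u = component F v"
    if "u \<in> ?W" "v \<in> ?W" for u v
    using that component_insert_cases[of a b F u v] component_mono_eq[of F ?G u v] by auto
  then have "card (component ?G ` ?W) = card (component F ` ?W)"
    using assms(1) by (intro antisym card_image_le_card_image) auto
  moreover have "component F ` V = insert (component F a) (component F ` ?W)"
    using assms by auto
  moreover have "component F a \<notin> component F ` ?W" by auto
  ultimately show ?thesis using assms(1) by simp
qed

lemma component_insert_eq:
  assumes "component F a = component F b"
  shows "component (insert {a, b} F) u = component F u"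
proof -
  have "component (insert {a, b} F) u = component (insert {a, b} F) v \<longleftrightarrow> component F u = component F v" for v
    using assms component_insert_cases[of a b F u v] component_mono_eq[of F "insert {a, b} F" u v]
    by auto
  then show ?thesis unfolding component_eq_iff by blast
qed

lemma graph_rank_insert:
  assumes "finite V" "a \<in> V" "b \<in> V"
  shows "graph_rank V (insert {a, b} F) =
    graph_rank V F + (if component F a = component F b then 0 else 1)"
proof (cases "component F a = component F b")
  case True
  then show ?thesis by (simp add: graph_rank_def component_insert_eq cong: image_cong)
next
  case False
  with card_component_insert[OF assms False] card_image_le[OF assms(1), of "component F"]
  show ?thesis by (simp add: graph_rank_def)
qed

lemma complete_graph_edgesE:
  assumes "e \<in> F" "F \<subseteq> complete_graph_edges V"
  obtains a b where "e = {a, b}" "a \<in> V" "b \<in> V"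
  using assms by (auto simp: complete_graph_edges_def card_2_iff)

lemma finite_complete_graph_edges: "finite V \<Longrightarrow> finite (complete_graph_edges V)"
  by (simp add: complete_graph_edges_def)

section \<open>Matroid properties of the rank\<close>

lemma graph_rank_le_card:
  assumes "finite V" "F \<subseteq> complete_graph_edges V"
  shows "graph_rank V F \<le> card F"
proof -
  have "finite F" using assms finite_complete_graph_edges finite_subset by blast
  then show ?thesis using assms(2)
  proof (induction F rule: finite_induct)
    case empty
    have "component {} u = {u}" for u :: 'a by (simp add: component_def adjacency_def)
    then show ?case by (simp add: graph_rank_def card_image)
  next
    case (insert e F)
    obtain a b where "e = {a, b}" "a \<in> V" "b \<in> V"
      using complete_graph_edgesE[OF insertI1 insert.prems] .
    with insert assms(1) show ?case by (simp add: graph_rank_insert)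
  qed
qed

lemma graph_rank_mono:
  assumes "finite V" "F \<subseteq> G"
  shows "graph_rank V F \<le> graph_rank V G"
proof -
  have "card (component G ` V) \<le> card (component F ` V)"
    using assms(1) component_mono_eq[OF assms(2)] by (rule card_image_le_card_image)
  then show ?thesis by (simp add: graph_rank_def)
qed

text \<open>An edge that joins different components of \<open>G\<close> also joins different
  components of the subgraph \<open>F\<close>.\<close>

lemma graph_rank_marginal:
  assumes "finite V" "F \<subseteq> G" "insert e G \<subseteq> complete_graph_edges V"
  shows "graph_rank V (insert e G) + graph_rank V F \<le> graph_rank V (insert e F) + graph_rank V G"
proof -
  obtain a b where "e = {a, b}" "a \<in> V" "b \<in> V"
    using complete_graph_edgesE[OF insertI1 assms(3)] .
  with assms component_mono_eq[of F G a b] show ?thesis by (simp add: graph_rank_insert)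
qed

section \<open>Lower bounds for the rank from degrees\<close>

lemma degree_le_graph_rank:
  assumes "finite V" "F \<subseteq> complete_graph_edges V" "v \<in> V"
  shows "card {e \<in> F. v \<in> e} \<le> graph_rank V F"
proof -
  define N where "N = {w. {v, w} \<in> F}"
  have N: "N \<subseteq> V" "v \<notin> N"
    using assms(2) by (auto simp: N_def complete_graph_edges_def)
  have finN: "finite N" using N(1) assms(1) by (rule finite_subset)
  have "{e \<in> F. v \<in> e} \<subseteq> (\<lambda>w. {v, w}) ` N"
  proof
    fix e assume e: "e \<in> {e \<in> F. v \<in> e}"
    then have "e \<in> F" by simp
    then obtain a b where "e = {a, b}" using complete_graph_edgesE[OF _ assms(2)] by blast
    with e show "e \<in> (\<lambda>w. {v, w}) ` N" unfolding N_def by (auto simp: insert_commute)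
  qed
  then have "card {e \<in> F. v \<in> e} \<le> card N"
    using finN surj_card_le by blast
  \<comment> \<open>All neighbours share the component of \<open>v\<close>, and \<open>v\<close>
    itself lies in \<open>V - N\<close>; hence dropping \<open>N\<close> loses no component.\<close>
  moreover have "component F ` V \<subseteq> component F ` (V - N)"
    using component_edge[of v _ F] N assms(3) unfolding N_def by blast
  then have "card (component F ` V) \<le> card (V - N)"
    using assms(1) by (meson finite_Diff surj_card_le)
  then have "card (component F ` V) + card N \<le> card V"
    using N finN assms(1) card_mono[OF assms(1) N(1)] by (simp add: card_Diff_subset)
  ultimately show ?thesis by (simp add: graph_rank_def)
qed

text \<open>Double counting of incidences, with each degree bounded by the rank. Summing over all
  vertices avoids both a division and the choice of a vertex of large degree.\<close>

lemma average_degree_le_graph_rank: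
  assumes "finite V" "F \<subseteq> complete_graph_edges V"
  shows "2 * card F \<le> card V * graph_rank V F"
proof -
  have finF: "finite F" using assms finite_complete_graph_edges finite_subset by blast
  have "2 * card F = (\<Sum>e\<in>F. card {v \<in> V. v \<in> e})"
  proof -
    have "card {v \<in> V. v \<in> e} = 2" if "e \<in> F" for e
    proof -
      have "{v \<in> V. v \<in> e} = e" "card e = 2"
        using that assms(2) by (auto simp: complete_graph_edges_def)
      then show ?thesis by simp
    qed
    then show ?thesis by simp
  qed
  also have "\<dots> = (\<Sum>v\<in>V. card {e \<in> F. v \<in> e})"
    by (rule sum_multicount_gen[symmetric]) (use assms finF in auto)
  also have "\<dots> \<le> (\<Sum>v\<in>V. graph_rank V F)"
    by (intro sum_mono degree_le_graph_rank assms)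
  finally show ?thesis by simp
qed

section \<open>Spanning trees\<close>

text \<open>After the closing edge is removed, the rest of the cycle still connects its
  ends.\<close>

lemma cycle_edge_redundant:
  assumes "graph_cycle F p"
  shows "\<exists>a b. {a, b} \<in> F \<and> component (F - {{a, b}}) a = component (F - {{a, b}}) b"
proof -
  define m where "m = length p - 1"
  let ?G = "F - {{p ! 0, p ! m}}"
  have m: "2 \<le> m" "length p = Suc m" "distinct p"
    using assms by (auto simp: graph_cycle_def m_def)
  have edge: "{p ! i, p ! (Suc i mod Suc m)} \<in> F" if "i \<le> m" for i
    using assms that m(2) by (simp add: graph_cycle_def)
  have "component ?G (p ! 0) = component ?G (p ! i)" if "i \<le> m" for i
    using that
  proof (induction i)
    case (Suc i)
    \<comment> \<open>Here a cycle needs length at least 3: for \<open>m = 1\<close> the edge at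
      \<open>i = 0\<close> would be the closing edge itself.\<close>
    have "{p ! i, p ! Suc i} \<noteq> {p ! 0, p ! m}"
      using m Suc.prems by (auto simp: doubleton_eq_iff nth_eq_iff_index_eq)
    with edge[of i] Suc.prems have "{p ! i, p ! Suc i} \<in> ?G" by simp
    from component_edge[OF this] Suc show ?case by simp
  qed simp
  moreover have "{p ! 0, p ! m} \<in> F" using edge[of m] by (simp add: insert_commute)
  ultimately show ?thesis by blast
qed

text \<open>Rank \<open>card V - 1\<close> leaves a single component. A cycle would contain an edge
  whose removal keeps the rank, so the rank would be below \<open>card T\<close>, contradicting the
  two bounds.\<close>

lemma graph_spanning_tree_if_rank:
  assumes "finite V" "V \<noteq> {}" "T \<subseteq> complete_graph_edges V"
    and "card T \<le> card V - 1" "card V - 1 \<le> graph_rank V T"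
  shows "graph_spanning_tree V (complete_graph_edges V) T"
proof -
  have "graph_connected V T"
    unfolding graph_connected_def
  proof (intro conjI ballI)
    fix u v assume uv: "u \<in> V" "v \<in> V"
    have "card V > 0" using assms by (simp add: card_gt_0_iff)
    then have "card (component T ` V) \<le> 1"
      using assms(5) card_image_le[OF assms(1), of "component T"] unfolding graph_rank_def by linarith
    then have "component T u = component T v"
      using uv assms(1) by (metis (no_types, lifting) One_nat_def card_le_Suc0_iff_eq finite_imageI imageI)
    then show "(u, v) \<in> (adjacency T)\<^sup>*" by (simp add: component_eq_iff) (simp add: component_def)
  qed (fact assms(2))
  moreover have "\<not> graph_cycle T p" for p
  proof
    assume "graph_cycle T p"
    then obtain a b where ab: "{a, b} \<in> T"
      "component (T - {{a, b}}) a = component (T - {{a, b}}) b"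
      using cycle_edge_redundant by blast
    let ?S = "T - {{a, b}}"
    have "a \<in> V" "b \<in> V" using ab(1) assms(3) by (auto simp: complete_graph_edges_def)
    with ab(2) have "graph_rank V (insert {a, b} ?S) = graph_rank V ?S"
      using assms(1) by (simp add: graph_rank_insert del: insert_Diff_single)
    also have "insert {a, b} ?S = T" using ab(1) by blast
    finally have "graph_rank V T \<le> card ?S"
      using graph_rank_le_card[of V ?S] assms by auto
    moreover have "card ?S < card T"
      using ab(1) assms finite_complete_graph_edges finite_subset by (metis card_Diff1_less)
    ultimately show False using assms by linarith
  qed
  ultimately show ?thesis
    using assms(1,3)
    by (auto simp: graph_spanning_tree_def graph_tree_def simple_graph_def complete_graph_edges_def)
qed

section \<open>Sizes of colour classes and the balanced tree\<close>

lemma card_colour_class: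
  assumes "edge_colouring k E c" "colour_balanced k c E" "finite E" "card E = k * m" "i \<in> {1..k}"
  shows "card {e \<in> E. c e = i} = m"
proof -
  have "card E = (\<Sum>j\<in>{1..k}. card {e \<in> E. c e = j})"
  proof -
    have "c ` E \<subseteq> {1..k}" using assms(1) by (simp add: edge_colouring_def image_subset_iff_funcset)
    with assms(3) have "(\<Sum>j\<in>{1..k}. \<Sum>e\<in>{e \<in> E. c e = j}. 1) = (\<Sum>e\<in>E. 1::nat)"
      by (intro sum.group finite_atLeastAtMost)
    then show ?thesis by (simp only: card_eq_sum)
  qed
  also have "\<dots> = (\<Sum>j\<in>{1..k}. card {e \<in> E. c e = i})"
    using assms(2,5) unfolding colour_balanced_def by (intro sum.cong refl) blast
  also have "\<dots> = k * card {e \<in> E. c e = i}" by simp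
  finally show ?thesis using assms(4,5) by simp
qed

theorem corollary1p8:
  fixes k t :: nat and V :: "'a set" and c :: "'a set \<Rightarrow> nat"
  assumes "k \<ge> 1" and "t \<ge> 1"
    and "finite V" and "card V = 2 * k * t + 1"
    and "edge_colouring k (complete_graph_edges V) c"
    and "colour_balanced k c (complete_graph_edges V)"
  shows "\<exists>T. graph_spanning_tree V (complete_graph_edges V) T \<and> colour_balanced k c T"
proof -
  let ?E = "complete_graph_edges V"
  \<comment> \<open>One index for each edge of the desired tree: \<open>2 * t\<close> per colour.
    The second coordinate only numbers the copies of a colour class, so \<open>A\<close> ignores
    it.\<close>
  define I where "I = {1..k} \<times> {1..2 * t}"
  define A where "A = (\<lambda>(i, j::nat). {e \<in> ?E. c e = i})"
  have finE: "finite ?E" using assms(3) by (rule finite_complete_graph_edges)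
  have finI: "finite I" and cardI: "card I = card V - 1"
    using assms(4) by (simp_all add: I_def)
  have "card ?E = card V choose 2"
    unfolding complete_graph_edges_def using assms(3) by (rule n_subsets)
  \<comment> \<open>Half of \<open>card V - 1 = 2 * k * t\<close> is \<open>k * t\<close>.\<close>
  also have "\<dots> = k * (t * card V)"
    by (simp add: choose_two assms(4) algebra_simps)
  finally have cardE: "card ?E = k * (t * card V)" .
  have card_class: "card {e \<in> ?E. c e = i} = t * card V" if "i \<in> {1..k}" for i
    using card_colour_class[OF assms(5,6) finE cardE that] .
  have hall: "card J \<le> graph_rank V (\<Union>(A ` J))" if "J \<subseteq> I" for J
  proof -
    \<comment> \<open>The union depends only on the colours occurring in \<open>J\<close>, while
      each colour accounts for at most \<open>2 * t\<close> indices; it is therefore enough to bound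
      the rank below by \<open>2 * t * card ?S\<close>.\<close>
    let ?S = "fst ` J" and ?F = "\<Union>(A ` J)"
    have S: "?S \<subseteq> {1..k}" "finite ?S"
      using that finite_subset[OF that finI] by (auto simp: I_def)
    have "?F = (\<Union>i\<in>?S. {e \<in> ?E. c e = i})" by (auto simp: A_def)
    then have "card ?F = (\<Sum>i\<in>?S. card {e \<in> ?E. c e = i})"
      using S finE by (simp only:) (rule card_UN_disjoint, auto)
    also have "\<dots> = card ?S * (t * card V)" using S card_class by (simp add: subset_iff)
    finally have "card V * (2 * t * card ?S) = 2 * card ?F" by simp
    also have "\<dots> \<le> card V * graph_rank V ?F"
      using assms(3) by (intro average_degree_le_graph_rank) (auto simp: A_def)
    finally have "2 * t * card ?S \<le> graph_rank V ?F"
      by (rule mult_le_cancel1[THEN iffD1, rule_format]) (simp add: assms(4))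
    moreover have "J \<subseteq> ?S \<times> {1..2 * t}" using that by (force simp: I_def)
    then have "card J \<le> card ?S * (2 * t)"
      using card_mono[of "?S \<times> {1..2 * t}" J] S by (simp add: card_cartesian_product)
    ultimately show ?thesis by (simp add: algebra_simps)
  qed
  have "\<exists>f. (\<forall>i\<in>I. f i \<in> A i) \<and> card I \<le> graph_rank V (f ` I)"
  proof (rule rado[OF finE finI])
    show "A x \<subseteq> ?E" for x by (auto simp: A_def)
    show "graph_rank V (X \<union> Y) + graph_rank V (X \<inter> Y) \<le> graph_rank V X + graph_rank V Y"
      if "X \<subseteq> ?E" "Y \<subseteq> ?E" for X Y
      using graph_rank_marginal[OF assms(3)] finE that by (rule submodular_if_decreasing_marginals)
    show "graph_rank V X \<le> graph_rank V Y" if "X \<subseteq> Y" for X Y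
      using assms(3) that by (rule graph_rank_mono)
  qed (fact graph_rank_le_card[OF assms(3)] hall)+
  then obtain f where f: "\<And>x. x \<in> I \<Longrightarrow> f x \<in> A x" and rank: "card I \<le> graph_rank V (f ` I)"
    by blast
  have T: "f ` I \<subseteq> ?E" using f by (fastforce simp: A_def)
  have "card I \<le> card (f ` I)" using rank graph_rank_le_card[OF assms(3) T] by linarith
  then have inj: "inj_on f I" using finI by (simp add: card_image_le eq_card_imp_inj_on le_antisym)
  have "graph_spanning_tree V ?E (f ` I)"
    using assms(3,4) T rank cardI card_image_le[OF finI, of f]
    by (intro graph_spanning_tree_if_rank) auto
  moreover have "card {e \<in> f ` I. c e = i} = 2 * t" if "i \<in> {1..k}" for i
  proof -
    \<comment> \<open>Every chosen edge carries the colour of its index, so the edges of colour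
      \<open>i\<close> come exactly from the copies of class \<open>i\<close>.\<close>
    have "{e \<in> f ` I. c e = i} = f ` ({i} \<times> {1..2 * t})"
      using f that by (fastforce simp: A_def I_def)
    moreover have "inj_on f ({i} \<times> {1..2 * t})"
      using that by (intro inj_on_subset[OF inj]) (auto simp: I_def)
    ultimately show ?thesis by (simp add: card_image card_cartesian_product)
  qed
  then have "colour_balanced k c (f ` I)" by (simp add: colour_balanced_def)
  ultimately show ?thesis by blast
qed

end
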